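(* Let $\mathcal D\subseteq\mathbb R^d$ be a nonempty closed set. For each $\theta\in\mathbb R^d$ let $\Pi^B_{\mathcal D}(\theta)$ denote the set of Euclidean projections of $\theta$ onto $\mathcal D$, and let $\Pi_{\mathcal D}(\theta)\in\Pi^B_{\mathcal D}(\theta)$ be a chosen element. Let $k(\theta):=\frac12\|\Pi_{\mathcal D}(\theta)\|^2$ and $q(\theta):=\frac12\|\theta-\Pi_{\mathcal D}(\theta)\|^2$. Suppose that (a) $\langle \Pi_{\mathcal D}(\theta),\theta-\Pi_{\mathcal D}(\theta)\rangle=0$ for every $\theta\in\mathbb R^d$; (b) $\Pi_{\mathcal D}(\theta)\in\partial k(\theta)$ for every $\theta\in\mathbb R^d$. Then for every fixed $t\in\mathbb R^d$, the function $$q_m(\theta,t):=\tfrac12\|\theta\|^2-\langle \Pi_{\mathcal D}(t),\theta-t\rangle-k(t)$$ is a majorization function of $q$ at $t$.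
   Context: $\|\cdot\|$ is the Euclidean norm and $\langle\cdot,\cdot\rangle$ the standard inner product. The set of projections is $\Pi^B_{\mathcal D}(\theta)=\operatorname{argmin}_{x\in\mathcal D}\|\theta-x\|$. The choice $\theta\mapsto\Pi_{\mathcal D}(\theta)$ is fixed throughout. The subdifferential is $\partial k(\theta)=\{v: k(u)\ge k(\theta)+\langle v,u-\theta\rangle\ \text{for all }u\in\mathbb R^d\}$. A function $q_m(\cdot,t)$ is a majorization function of $q$ at $t$ if $q_m(t,t)=q(t)$ and $q_m(\theta,t)\ge q(\theta)$ for all $\theta\in\mathbb R^d$. *)

theory Defs
  imports "HOL-Analysis.Analysis"
begin

text \<open>Projections are set-valued: on a nonconvex set there may be several nearest points,
  so the unique-valued \<open>closest_point\<close> is not used.\<close>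

definition projections :: "(real ^ 'n) set \<Rightarrow> real ^ 'n \<Rightarrow> (real ^ 'n) set" where
  "projections D \<theta> = {x. is_arg_min (\<lambda>x. norm (\<theta> - x)) (\<lambda>x. x \<in> D) x}"

definition subdifferential :: "(real ^ 'n \<Rightarrow> real) \<Rightarrow> real ^ 'n \<Rightarrow> (real ^ 'n) set" where
  "subdifferential f \<theta> = {v. \<forall>u. f u \<ge> f \<theta> + v \<bullet> (u - \<theta>)}"

definition majorization_at ::
    "(real ^ 'n \<Rightarrow> real ^ 'n \<Rightarrow> real) \<Rightarrow> (real ^ 'n \<Rightarrow> real) \<Rightarrow> real ^ 'n \<Rightarrow> bool" where
  "majorization_at g f t \<longleftrightarrow> g t t = f t \<and> (\<forall>\<theta>. g \<theta> t \<ge> f \<theta>)"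

text \<open>In the following, \<open>P\<close> is the chosen selection of projections.\<close>

definition proj_half_sqnorm :: "(real ^ 'n \<Rightarrow> real ^ 'n) \<Rightarrow> real ^ 'n \<Rightarrow> real" where
  "proj_half_sqnorm P \<theta> = 1/2 * (norm (P \<theta>))\<^sup>2"

definition proj_half_sqdist :: "(real ^ 'n \<Rightarrow> real ^ 'n) \<Rightarrow> real ^ 'n \<Rightarrow> real" where
  "proj_half_sqdist P \<theta> = 1/2 * (norm (\<theta> - P \<theta>))\<^sup>2"

definition proj_majorant ::
    "(real ^ 'n \<Rightarrow> real ^ 'n) \<Rightarrow> real ^ 'n \<Rightarrow> real ^ 'n \<Rightarrow> real" where
  "proj_majorant P \<theta> t = 1/2 * (norm \<theta>)\<^sup>2 - P t \<bullet> (\<theta> - t) - proj_half_sqnorm P t"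

end

theory Submission
  imports Defs
begin

text \<open>Orthogonality of \<open>P \<theta>\<close> and \<open>\<theta> - P \<theta>\<close> and Pythagoras give \<open>q \<theta> = \<parallel>\<theta>\<parallel>\<^sup>2 / 2 - k \<theta>\<close>;
  minorizing \<open>k\<close> by its supporting affine function at \<open>t\<close> then majorizes \<open>q\<close>.\<close>

lemma proj_half_sqdist_eq:
  fixes P :: "real ^ 'n \<Rightarrow> real ^ 'n"
  assumes "P \<theta> \<bullet> (\<theta> - P \<theta>) = 0"
  shows "proj_half_sqdist P \<theta> = 1/2 * (norm \<theta>)\<^sup>2 - proj_half_sqnorm P \<theta>"
  \<comment> \<open>Expanding the squared norms into inner products leaves the cross term
    \<open>P \<theta> \<bullet> \<theta>\<close>, which orthogonality turns into
    \<open>P \<theta> \<bullet> P \<theta>\<close>.\<close>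
  using assms unfolding proj_half_sqdist_def proj_half_sqnorm_def
  by (simp add: power2_norm_eq_inner inner_diff_left inner_diff_right inner_commute field_simps)

theorem theorem3p1:
  fixes D :: "(real ^ 'n) set" and P :: "real ^ 'n \<Rightarrow> real ^ 'n"
  assumes "D \<noteq> {}" and "closed D"
    and "\<And>\<theta>. P \<theta> \<in> projections D \<theta>"
    and "\<And>\<theta>. P \<theta> \<bullet> (\<theta> - P \<theta>) = 0"
    and "\<And>\<theta>. P \<theta> \<in> subdifferential (proj_half_sqnorm P) \<theta>"
  shows "\<forall>t. majorization_at (proj_majorant P) (proj_half_sqdist P) t"
proof
  fix t
  have "proj_half_sqnorm P \<theta> \<ge> proj_half_sqnorm P t + P t \<bullet> (\<theta> - t)" for \<theta>
    using assms(5)[of t] unfolding subdifferential_def by blast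
  \<comment> \<open>The terms \<open>1/2 * (norm \<theta>)\<^sup>2\<close> cancel, so the gap
    between the two sides is exactly the slack in the subgradient inequality for
    \<open>proj_half_sqnorm P\<close> at \<open>t\<close>.\<close>
  then have "proj_majorant P \<theta> t \<ge> proj_half_sqdist P \<theta>" for \<theta>
    unfolding proj_majorant_def proj_half_sqdist_eq[OF assms(4)] by (smt (verit))
  \<comment> \<open>That slack is zero at \<open>\<theta> = t\<close>, where the linear term
    vanishes.\<close>
  moreover have "proj_majorant P t t = proj_half_sqdist P t"
    unfolding proj_majorant_def proj_half_sqdist_eq[OF assms(4)] by simp
  ultimately show "majorization_at (proj_majorant P) (proj_half_sqdist P) t"
    unfolding majorization_at_def by blast
qed

end
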